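(* Let $\alpha\ge1$ be an integer and let $G=(V,E)$ be a graph with chromatic number $\chi(G)\le\alpha$. Then $G$ admits a partial edge colouring with at most $3\lceil\log_2\alpha\rceil+16$ colours such that every non-isolated edge of $G$ is satisfied.
   Context: For an edge $e=uv$, $E[e]$ is the set of edges incident with $u$ or $v$ and $E(e)=E[e]\setminus\{e\}$; $e$ is isolated if $E(e)=\emptyset$. In a partial edge colouring (not all edges need be coloured), a colour $\beta$ is unique for $e$ if $\beta$ appears on some edge $e'\in E(e)$ and on no other edge of $E[e]\setminus\{e'\}$; $e$ is satisfied if such a colour exists. *)

theory Defs
  imports Complex_Main
begin

definition simple_graph :: "'a set \<Rightarrow> 'a set set \<Rightarrow> bool" where
  "simple_graph V E \<longleftrightarrow> finite V \<and> (\<forall>e\<in>E. e \<subseteq> V \<and> card e = 2)"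

definition colourable :: "'a set \<Rightarrow> 'a set set \<Rightarrow> nat \<Rightarrow> bool" where
  "colourable V E k \<longleftrightarrow>
     (\<exists>f :: 'a \<Rightarrow> nat. (\<forall>v\<in>V. f v < k) \<and> (\<forall>u v. {u, v} \<in> E \<longrightarrow> f u \<noteq> f v))"

definition closed_edge_nbhd :: "'a set set \<Rightarrow> 'a set \<Rightarrow> 'a set set" where
  "closed_edge_nbhd E e = {f \<in> E. f \<inter> e \<noteq> {}}"

definition open_edge_nbhd :: "'a set set \<Rightarrow> 'a set \<Rightarrow> 'a set set" where
  "open_edge_nbhd E e = closed_edge_nbhd E e - {e}"

definition isolated_edge :: "'a set set \<Rightarrow> 'a set \<Rightarrow> bool" where
  "isolated_edge E e \<longleftrightarrow> open_edge_nbhd E e = {}"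

text \<open>A partial edge colouring is c :: 'a set => 'b option (None = uncoloured).
  Colour b is unique for e if it occurs on some e' in E(e) and on no other edge of E[e] - {e'}.\<close>
definition unique_colour :: "'a set set \<Rightarrow> ('a set \<Rightarrow> 'b option) \<Rightarrow> 'a set \<Rightarrow> 'b \<Rightarrow> bool" where
  "unique_colour E c e b \<longleftrightarrow>
     (\<exists>e'\<in>open_edge_nbhd E e. c e' = Some b \<and>
        (\<forall>e''\<in>closed_edge_nbhd E e - {e'}. c e'' \<noteq> Some b))"

definition satisfied :: "'a set set \<Rightarrow> ('a set \<Rightarrow> 'b option) \<Rightarrow> 'a set \<Rightarrow> bool" where
  "satisfied E c e \<longleftrightarrow> (\<exists>b. unique_colour E c e b)"

end

theory Submission
  imports Defs
begin

text \<open>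
  In each component take a breadth-first tree from a root of degree at least two and colour the edge
  from \<open>v\<close> to its parent by the depth of \<open>v\<close> modulo 3 together with a label \<open>g v < 3\<close>. Whatever \<open>g\<close> is, this
  satisfies every edge whose ends differ in depth or in label; with two extra colours at the root it
  costs 11 colours.

  The remaining edges join vertices of equal depth. A proper colouring \<open>f\<close> with values below \<open>2 ^ k\<close>,
  where \<open>k\<close> is the rounded-up binary logarithm of \<open>\<alpha>\<close>, splits them into \<open>k\<close> bipartite levels by the
  highest bit in which the colours of the ends differ. Three colours per level satisfy every edge
  that is not isolated in its level. If \<open>f\<close> is chosen to push the edges to the highest possible levels,
  the edges isolated in their level form a graph of maximum degree at most two, so \<open>g\<close> can be
  chosen to separate the ends of each of them.
\<close>

section \<open>Elementary rules for satisfied edges and minimal subsets\<close>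

lemma satisfiedI:
  assumes "e' \<in> E" "e' \<noteq> e" "e' \<inter> e \<noteq> {}" "c e' = Some b"
    and "\<And>e''. e'' \<in> E \<Longrightarrow> e'' \<inter> e \<noteq> {} \<Longrightarrow> c e'' = Some b \<Longrightarrow> e'' = e'"
  shows "satisfied E c e"
  using assms
  unfolding satisfied_def unique_colour_def open_edge_nbhd_def closed_edge_nbhd_def by blast

lemma satisfiedE:
  assumes "satisfied E c e"
  obtains e' b where "e' \<in> E" "e' \<noteq> e" "e' \<inter> e \<noteq> {}" "c e' = Some b"
    and "\<And>e''. e'' \<in> E \<Longrightarrow> e'' \<inter> e \<noteq> {} \<Longrightarrow> c e'' = Some b \<Longrightarrow> e'' = e'"
  using assms
  unfolding satisfied_def unique_colour_def open_edge_nbhd_def closed_edge_nbhd_def by blast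

lemma not_isolated_edgeE:
  assumes "\<not> isolated_edge E e"
  obtains e' where "e' \<in> E" "e' \<noteq> e" "e' \<inter> e \<noteq> {}"
  using assms unfolding isolated_edge_def open_edge_nbhd_def closed_edge_nbhd_def by blast

text \<open>Supplies the minimal edge cover and the minimal dominating set below. Deleting single
  elements is the form of minimality that yields private vertices; a subset of least size has
  it.\<close>

lemma finite_minimal_subset:
  assumes "finite S" "P S"
  obtains T where "T \<subseteq> S" "P T" "\<And>x. x \<in> T \<Longrightarrow> \<not> P (T - {x})"
proof -
  have "\<exists>T. (T \<subseteq> S \<and> P T) \<and> (\<forall>U. U \<subseteq> S \<and> P U \<longrightarrow> card T \<le> card U)"
    using ex_has_least_nat[of "\<lambda>T. T \<subseteq> S \<and> P T" S card] assms(2) by blast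
  then obtain T where T: "T \<subseteq> S" "P T" "\<And>U. U \<subseteq> S \<Longrightarrow> P U \<Longrightarrow> card T \<le> card U" by blast
  have "\<not> P (T - {x})" if "x \<in> T" for x
  proof
    assume "P (T - {x})"
    then have "card T \<le> card (T - {x})" using T by blast
    moreover have "card (T - {x}) < card T"
      using that assms(1) T(1) by (meson card_Diff1_less finite_subset)
    ultimately show False by simp
  qed
  then show ?thesis using that T by blast
qed

section \<open>Bipartite graphs\<close>

text \<open>A minimal edge cover is a forest of stars; colour one edge of each star \<open>1\<close> and the
  others \<open>0\<close>.\<close>
lemma star_cover_colouring:
  assumes "finite K" and "\<forall>e\<in>K. card e = 2"
  obtains s :: "'a set \<Rightarrow> nat option" where
    "\<And>e b. s e = Some b \<Longrightarrow> e \<in> K \<and> b < 2"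
    "\<And>v. v \<in> \<Union>K \<Longrightarrow> \<exists>e b. v \<in> e \<and> s e = Some b \<and> (\<forall>e'. v \<in> e' \<longrightarrow> s e' = Some b \<longrightarrow> e' = e)"
proof -
  obtain C where C: "C \<subseteq> K" "\<Union>K \<subseteq> \<Union>C"
    and min: "\<And>e. e \<in> C \<Longrightarrow> \<not> \<Union>K \<subseteq> \<Union>(C - {e})"
    using finite_minimal_subset[of K "\<lambda>C. \<Union>K \<subseteq> \<Union>C"] assms(1) by blast
  define centre where "centre v \<longleftrightarrow> (\<exists>e\<in>C. \<exists>e'\<in>C. e \<noteq> e' \<and> v \<in> e \<and> v \<in> e')" for v
  define m where "m v = (SOME e. e \<in> C \<and> v \<in> e)" for v
  have m: "m v \<in> C \<and> v \<in> m v" if "centre v" for v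
    unfolding m_def by (rule someI_ex) (use that centre_def in blast)
  define s where "s e = (if e \<notin> C then None else if \<exists>v. centre v \<and> e = m v then Some 1 else Some (0::nat))" for e
  \<comment> \<open>By minimality \<open>e\<close> has an end \<open>x\<close> covered by no other
    edge of \<open>C\<close>, so \<open>x\<close> is not a centre; two distinct centres on
    \<open>e\<close> would give it three ends.\<close>
  have one_centre: "v = w" if "e \<in> C" "v \<in> e" "w \<in> e" "centre v" "centre w" for e v w
  proof (rule ccontr)
    assume "v \<noteq> w"
    moreover obtain x where x: "x \<in> \<Union>K" "x \<notin> \<Union>(C - {e})" using min[OF \<open>e \<in> C\<close>] by blast
    then have "x \<in> e" "\<not> centre x" using C unfolding centre_def by blast+
    ultimately have distinct: "v \<noteq> w" "x \<noteq> v" "x \<noteq> w" "x \<in> e" using that by auto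
    have "card e = 2" using assms(2) C(1) that(1) by blast
    then show False using distinct that(2,3) by (auto simp: card_2_iff)
  qed
  show thesis
  proof (rule that[of s])
    fix e b assume "s e = Some b"
    then show "e \<in> K \<and> b < 2" using C(1) by (auto simp: s_def split: if_splits)
  next
    fix v assume "v \<in> \<Union>K"
    then obtain e where e: "e \<in> C" "v \<in> e" using C by blast
    show "\<exists>e b. v \<in> e \<and> s e = Some b \<and> (\<forall>e'. v \<in> e' \<longrightarrow> s e' = Some b \<longrightarrow> e' = e)"
    proof (cases "centre v")
      case True
      \<comment> \<open>An edge of colour \<open>1\<close> at \<open>v\<close> is \<open>m w\<close>
        for a centre \<open>w\<close> on it, and two centres on one cover edge coincide.\<close>
      have "e' = m v" if "v \<in> e'" "s e' = Some 1" for e'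
      proof -
        from that obtain w where w: "centre w" "e' = m w" by (auto simp: s_def split: if_splits)
        then show ?thesis using one_centre[of "m w" v w] m True that by blast
      qed
      moreover have "s (m v) = Some 1" using m True by (auto simp: s_def)
      ultimately show ?thesis using m True by blast
    next
      case False
      \<comment> \<open>A vertex that is not a centre lies on a single cover edge, and edges outside
        \<open>C\<close> are uncoloured.\<close>
      have "e' = e" if "v \<in> e'" "s e' \<noteq> None" for e'
        using that False e unfolding centre_def s_def by (auto split: if_splits)
      moreover obtain b where "s e = Some b" using e unfolding s_def by (cases "\<exists>v. centre v \<and> e = m v") auto
      ultimately show ?thesis using e(2) by (metis option.distinct(1))
    qed
  qed
qed

text \<open>Let \<open>B1\<close> be a minimal set dominating the side \<open>A\<close>, avoiding leaves where possible, and let \<open>p b\<close> be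
  a private neighbour of \<open>b \<in> B1\<close>. Colour \<open>2\<close> on the edges \<open>b p b\<close> satisfies the other edges at \<open>B1\<close>
  and all edges from a private neighbour to the outside of \<open>B1\<close>; the star colouring between \<open>B1\<close> and
  the non-private vertices of \<open>A\<close> satisfies the rest, unless \<open>p b\<close> is the centre of a star component,
  which gets one more edge of colour \<open>1\<close>.\<close>
lemma bipartite_colouring:
  fixes H :: "'a set set"
  assumes fin: "finite H"
    and bip: "\<forall>e\<in>H. \<exists>a b. e = {a, b} \<and> S a \<and> \<not> S b"
  obtains h :: "'a set \<Rightarrow> nat option" where
    "\<And>e b. h e = Some b \<Longrightarrow> e \<in> H \<and> b < 3"
    "\<And>e. e \<in> H \<Longrightarrow> \<not> isolated_edge H e \<Longrightarrow> satisfied H h e"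
proof -
  define adj where "adj a b \<longleftrightarrow> S a \<and> \<not> S b \<and> {a, b} \<in> H" for a b
  define A where "A = {a. \<exists>b. adj a b}"
  define leaf where "leaf b \<longleftrightarrow> (\<exists>!a. adj a b)" for b
  \<comment> \<open>Left out are the leaves whose neighbour also has a non-leaf neighbour; this
    later makes every \<open>t b\<close> a leaf.\<close>
  define B' where "B' = {b. (\<exists>a. adj a b) \<and> (leaf b \<longrightarrow> (\<forall>a b'. adj a b \<longrightarrow> adj a b' \<longrightarrow> leaf b'))}"
  have adj_edge: "\<exists>a b. e = {a, b} \<and> adj a b" if "e \<in> H" for e
    using bspec[OF bip that] that unfolding adj_def by blast
  have edge_eq: "{a, b} = {a', b'} \<longleftrightarrow> a = a' \<and> b = b'" if "adj a b" "adj a' b'" for a b a' b'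
    using that unfolding adj_def by (auto simp: doubleton_eq_iff)
  have meets: "{a, b} \<inter> {a', b'} \<noteq> {} \<longleftrightarrow> a = a' \<or> b = b'" if "adj a b" "adj a' b'" for a b a' b'
    using that unfolding adj_def by auto
  have "B' \<subseteq> \<Union>H" unfolding B'_def adj_def by blast
  moreover have "finite (\<Union>H)"
    using fin bip by (metis (no_types, lifting) finite.emptyI finite_Union finite_insert)
  ultimately have "finite B'" by (rule finite_subset)
  \<comment> \<open>No domination is lost: a vertex with a non-leaf neighbour uses that one, and
    otherwise all its neighbours are leaves that were kept.\<close>
  moreover have "\<forall>a\<in>A. \<exists>b\<in>B'. adj a b"
  proof
    fix a assume "a \<in> A"
    then obtain b where b: "adj a b" unfolding A_def by blast
    show "\<exists>b\<in>B'. adj a b"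
    proof (cases "\<exists>b'. adj a b' \<and> \<not> leaf b'")
      case True
      then show ?thesis unfolding B'_def by blast
    next
      case False
      then have "leaf b" using b by blast
      then have "\<forall>a'. adj a' b \<longrightarrow> a' = a" using b unfolding leaf_def by blast
      then have "b \<in> B'" using False b unfolding B'_def by blast
      then show ?thesis using b by blast
    qed
  qed
  ultimately obtain B1 where B1: "B1 \<subseteq> B'" "\<forall>a\<in>A. \<exists>b\<in>B1. adj a b"
    and min: "\<And>b. b \<in> B1 \<Longrightarrow> \<not> (\<forall>a\<in>A. \<exists>b\<in>B1 - {b}. adj a b)"
    using finite_minimal_subset[of B' "\<lambda>X. \<forall>a\<in>A. \<exists>b\<in>X. adj a b"] by blast
  \<comment> \<open>Without \<open>b\<close> some vertex of \<open>A\<close> would be undominated;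
    it is private to \<open>b\<close>.\<close>
  have "\<exists>a. adj a b \<and> (\<forall>b'\<in>B1. adj a b' \<longrightarrow> b' = b)" if "b \<in> B1" for b
    using min[OF that] B1(2) that unfolding A_def by blast
  then obtain p where p: "\<And>b. b \<in> B1 \<Longrightarrow> adj (p b) b"
    and priv: "\<And>b b'. b \<in> B1 \<Longrightarrow> b' \<in> B1 \<Longrightarrow> adj (p b) b' \<Longrightarrow> b' = b"
    by metis
  define P where "P = p ` B1"
  have inj_p: "b = b'" if "b \<in> B1" "b' \<in> B1" "p b = p b'" for b b'
    using that p priv by metis
  define K where "K = {{a, b} |a b. adj a b \<and> a \<notin> P \<and> b \<in> B1}"
  have "K \<subseteq> H" unfolding K_def adj_def by blast
  then have finK: "finite K" using fin by (rule finite_subset)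
  have cardK: "\<forall>e\<in>K. card e = 2"
    unfolding K_def adj_def by (auto simp: card_2_iff doubleton_eq_iff)
  obtain s :: "'a set \<Rightarrow> nat option" where
    s: "\<And>e b. s e = Some b \<Longrightarrow> e \<in> K \<and> b < 2"
    and s_unique: "\<And>v. v \<in> \<Union>K \<Longrightarrow> \<exists>e b. v \<in> e \<and> s e = Some b \<and> (\<forall>e'. v \<in> e' \<longrightarrow> s e' = Some b \<longrightarrow> e' = e)"
    by (rule star_cover_colouring[OF finK cardK]) (rule that)
  \<comment> \<open>Here the edge from \<open>p b\<close> to \<open>b\<close> meets no other edge at
    \<open>b\<close>, and neither colour \<open>2\<close> nor \<open>s\<close> colours another edge
    at \<open>p b\<close>, so one more coloured edge is required there.\<close>
  define pend where "pend b \<longleftrightarrow> b \<in> B1 \<and> leaf b \<and> (\<exists>b'. b' \<noteq> b \<and> adj (p b) b')" for b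
  define t where "t b = (SOME b'. b' \<noteq> b \<and> adj (p b) b')" for b
  have t: "t b \<noteq> b \<and> adj (p b) (t b)" if "pend b" for b
    unfolding t_def by (rule someI_ex) (use that pend_def in blast)
  \<comment> \<open>A leaf in \<open>B'\<close> has a neighbour all of whose neighbours are leaves.
    Hence the extra edge meets other edges only at \<open>p b\<close>.\<close>
  have t_leaf: "leaf (t b)" if "pend b" for b
    using that t[OF that] p B1(1) unfolding pend_def B'_def by blast
  have t_B1: "t b \<notin> B1" if "pend b" for b
    using that t[OF that] priv unfolding pend_def by blast
  define M where "M = {{p b, b} |b. b \<in> B1}"
  define X where "X = {{p b, t b} |b. pend b}"
  define h where "h e = (if e \<in> M then Some 2 else if e \<in> X then Some 1 else s e)" for e
  have M_iff: "{a, b} \<in> M \<longleftrightarrow> b \<in> B1 \<and> a = p b" if "adj a b" for a b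
    using that p edge_eq unfolding M_def by blast
  have X_iff: "{a, b} \<in> X \<longleftrightarrow> (\<exists>b'. pend b' \<and> a = p b' \<and> b = t b')" if "adj a b" for a b
    using that t edge_eq unfolding X_def by blast
  have K_iff: "{a, b} \<in> K \<longleftrightarrow> a \<notin> P \<and> b \<in> B1" if "adj a b" for a b
  proof
    assume "{a, b} \<in> K"
    then obtain a' b' where "{a, b} = {a', b'}" "adj a' b'" "a' \<notin> P" "b' \<in> B1"
      unfolding K_def by blast
    then show "a \<notin> P \<and> b \<in> B1" using edge_eq[OF that, of a' b'] by simp
  qed (use that K_def in blast)
  have h2: "h {a, b} = Some 2 \<longleftrightarrow> b \<in> B1 \<and> a = p b" if "adj a b" for a b
    using M_iff[OF that] s[of "{a, b}" 2] unfolding h_def by auto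
  have h_K: "h {a, b} = s {a, b}" if "adj a b" "a \<notin> P" for a b
    using that M_iff[OF that(1)] X_iff[OF that(1)] unfolding h_def P_def pend_def by auto
  \<comment> \<open>At a private vertex \<open>s\<close> is absent, as \<open>K\<close> avoids
    \<open>P\<close>, and the only edge into \<open>B1\<close> is the one of colour
    \<open>2\<close>.\<close>
  have h_P: "h {a, b} = (if b \<in> B1 then Some 2 else if {a, b} \<in> X then Some 1 else None)"
    if "adj a b" "a \<in> P" for a b
  proof -
    have "s {a, b} = None" using K_iff[OF that(1)] s that(2) by (metis not_None_eq)
    moreover have "a = p b" if "b \<in> B1" using \<open>a \<in> P\<close> \<open>adj a b\<close> priv that unfolding P_def by blast
    ultimately show ?thesis using M_iff[OF that(1)] unfolding h_def by auto
  qed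
  show thesis
  proof (rule that[of h])
    fix e b assume "h e = Some b"
    moreover have "M \<subseteq> H" "X \<subseteq> H" using p t unfolding M_def X_def adj_def by blast+
    ultimately show "e \<in> H \<and> b < 3" using s[of e b] \<open>K \<subseteq> H\<close>
      unfolding h_def by (auto split: if_splits)
  next
    fix e assume "e \<in> H" and non_iso: "\<not> isolated_edge H e"
    then obtain a b where e: "e = {a, b}" and ab: "adj a b" using adj_edge by blast
    have sat: "satisfied H h e"
      if "adj a' b'" "(a', b') \<noteq> (a, b)" "a' = a \<or> b' = b" "h {a', b'} = Some x"
        "\<And>a'' b''. adj a'' b'' \<Longrightarrow> a'' = a \<or> b'' = b \<Longrightarrow> h {a'', b''} = Some x \<Longrightarrow> a'' = a' \<and> b'' = b'"
      for a' b' x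
    proof (rule satisfiedI)
      show "{a', b'} \<in> H" using that(1) adj_def by blast
      show "{a', b'} \<noteq> e" using that(1,2) ab e edge_eq by auto
      show "{a', b'} \<inter> e \<noteq> {}" using that(3) e by blast
      show "h {a', b'} = Some x" by fact
      fix e'' assume "e'' \<in> H" "e'' \<inter> e \<noteq> {}" "h e'' = Some x"
      then obtain a'' b'' where "e'' = {a'', b''}" "adj a'' b''" using adj_edge by blast
      with that(5)[of a'' b''] \<open>e'' \<inter> e \<noteq> {}\<close> \<open>h e'' = Some x\<close> meets ab e
      show "e'' = {a', b'}" by blast
    qed
    consider (other) "b \<in> B1" "a \<noteq> p b" | (mate) "b \<in> B1" "a = p b" | (outP) "b \<notin> B1" "a \<in> P"
      | (out) "b \<notin> B1" "a \<notin> P" by blast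
    then show "satisfied H h e"
    proof cases
      \<comment> \<open>The private edge at \<open>b\<close> has colour \<open>2\<close>; no edge of
        colour \<open>2\<close> meets \<open>a\<close>, which is not private.\<close>
      case other
      then have "a \<notin> P" using priv ab unfolding P_def by blast
      then show ?thesis
        using other p h2 unfolding P_def by (intro sat[of "p b" b 2]) auto
    next
      case mate
      show ?thesis
      proof (cases "leaf b")
        case True
        then have b_only: "a'' = a" if "adj a'' b" for a'' using that ab unfolding leaf_def by blast
        \<comment> \<open>As \<open>e\<close> is not isolated and \<open>b\<close> is a leaf, a
          further edge leaves \<open>a\<close>, so the extra edge of colour \<open>1\<close>
          exists.\<close>
        obtain e' where e': "e' \<in> H" "e' \<noteq> e" "e' \<inter> e \<noteq> {}" using non_iso by (rule not_isolated_edgeE)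
        then obtain a' b' where "e' = {a', b'}" "adj a' b'" using adj_edge by blast
        then have "a' = a" "b' \<noteq> b" "adj a b'" using e' e ab meets b_only by blast+
        then have pend: "pend b" using mate True unfolding pend_def by blast
        have "a \<in> P" using mate P_def by blast
        show ?thesis
        proof (rule sat[of a "t b" 1])
          show "adj a (t b)" using t[OF pend] mate by simp
          show "(a, t b) \<noteq> (a, b)" using t[OF pend] by simp
          show "h {a, t b} = Some 1"
            using h_P[OF \<open>adj a (t b)\<close> \<open>a \<in> P\<close>] X_iff[OF \<open>adj a (t b)\<close>] t_B1[OF pend] pend mate by auto
          fix a'' b'' assume *: "adj a'' b''" "a'' = a \<or> b'' = b" "h {a'', b''} = Some 1"
          then have "a'' = a" using b_only by blast
          then have "{a'', b''} \<in> X" using h_P[OF *(1)] * \<open>a \<in> P\<close> by (auto split: if_splits)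
          then obtain b0 where b0: "pend b0" "a'' = p b0" "b'' = t b0" using X_iff[OF *(1)] by blast
          then have "b0 = b" using \<open>a'' = a\<close> mate inj_p unfolding pend_def by metis
          then show "a'' = a \<and> b'' = t b" using b0 mate by simp
        qed auto
      next
        case False
        \<comment> \<open>The second neighbour of \<open>b\<close> is not private, so
          \<open>s\<close> provides a colour unique at \<open>b\<close>. It does not occur at
          \<open>a\<close>, where an extra edge would require \<open>b\<close> to be a leaf.\<close>
        then obtain a1 where a1: "adj a1 b" "a1 \<noteq> a" using ab unfolding leaf_def by blast
        have not_P: "a'' \<notin> P" if "adj a'' b" "a'' \<noteq> a" for a''
          using that priv mate unfolding P_def by blast
        have "b \<in> \<Union>K" using a1 not_P[OF a1] mate unfolding K_def by blast
        from s_unique[OF this] obtain e' x where e': "b \<in> e'" "s e' = Some x"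
          and e'_uniq: "\<And>e''. b \<in> e'' \<Longrightarrow> s e'' = Some x \<Longrightarrow> e'' = e'" by blast
        have "e' \<in> K" "x < 2" using s[OF e'(2)] by auto
        then obtain a' where a': "e' = {a', b}" "adj a' b" "a' \<notin> P"
          using e'(1) ab unfolding K_def adj_def by blast
        have "a \<in> P" using mate P_def by blast
        show ?thesis
        proof (rule sat[of a' b x])
          show "adj a' b" by fact
          show "(a', b) \<noteq> (a, b)" using a' \<open>a \<in> P\<close> by auto
          show "h {a', b} = Some x" using h_K a' e' by auto
          fix a'' b'' assume *: "adj a'' b''" "a'' = a \<or> b'' = b" "h {a'', b''} = Some x"
          show "a'' = a' \<and> b'' = b"
          proof (cases "a'' = a")
            case True
            then have "{a'', b''} \<in> X" using h_P[OF *(1)] * \<open>a \<in> P\<close> \<open>x < 2\<close> by (auto split: if_splits)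
            then obtain b0 where b0: "pend b0" "a'' = p b0" using X_iff[OF *(1)] by blast
            then have "b0 = b" using True mate inj_p unfolding pend_def by metis
            then show ?thesis using b0 False unfolding pend_def by blast
          next
            case neq: False
            then have "b'' = b" using * by blast
            then have "s {a'', b} = Some x" using h_K[OF *(1)] not_P neq * by auto
            then have "{a'', b} = {a', b}" using e'_uniq a' by blast
            then show ?thesis using \<open>b'' = b\<close> by (auto simp: doubleton_eq_iff)
          qed
        qed auto
      qed
    next
      \<comment> \<open>Edges of colour \<open>2\<close> end in \<open>B1\<close>, so near
        \<open>e\<close> the only one is the private edge at \<open>a\<close>.\<close>
      case outP
      then obtain b1 where b1: "b1 \<in> B1" "a = p b1" unfolding P_def by blast
      show ?thesis
      proof (rule sat[of a b1 2])
        show "adj a b1" using b1 p by blast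
        then show "h {a, b1} = Some 2" using h2 b1 by blast
        show "(a, b1) \<noteq> (a, b)" using b1 outP by auto
        fix a'' b'' assume *: "adj a'' b''" "a'' = a \<or> b'' = b" "h {a'', b''} = Some 2"
        then have b'': "b'' \<in> B1" "a'' = p b''" using h2[OF *(1)] by auto
        then have "a'' = a" using *(2) outP by blast
        moreover have "b'' = b1"
          by (rule inj_p[OF b''(1) b1(1)]) (use b'' b1 \<open>a'' = a\<close> in metis)
        ultimately show "a'' = a \<and> b'' = b1" by blast
      qed auto
    next
      \<comment> \<open>Now \<open>s\<close> provides a colour unique at \<open>a\<close>. Another
        coloured edge at \<open>b\<close> would have to be an extra edge, but then \<open>b\<close>
        would be a leaf.\<close>
      case out
      have "a \<in> A" using ab A_def by blast
      then obtain b2 where "b2 \<in> B1" "adj a b2" using B1(2) by blast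
      then have "a \<in> \<Union>K" using K_iff[of a b2] out by blast
      from s_unique[OF this] obtain e' x where e': "a \<in> e'" "s e' = Some x"
        and e'_uniq: "\<And>e''. a \<in> e'' \<Longrightarrow> s e'' = Some x \<Longrightarrow> e'' = e'" by blast
      have "e' \<in> K" "x < 2" using s[OF e'(2)] by auto
      then obtain b' where b': "e' = {a, b'}" "adj a b'" "b' \<in> B1"
        using e'(1) ab unfolding K_def adj_def by blast
      show ?thesis
      proof (rule sat[of a b' x])
        show "adj a b'" by fact
        show "(a, b') \<noteq> (a, b)" using b' out by auto
        show "h {a, b'} = Some x" using h_K b' e' out by auto
        fix a'' b'' assume *: "adj a'' b''" "a'' = a \<or> b'' = b" "h {a'', b''} = Some x"
        have "a'' = a"
        proof (rule ccontr)
          assume "a'' \<noteq> a"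
          then have b'': "b'' = b" using * by blast
          show False
          proof (cases "a'' \<in> P")
            case True
            then have "{a'', b''} \<in> X" using h_P[OF *(1)] * out b'' by (auto split: if_splits)
            then obtain b0 where b0: "pend b0" "b'' = t b0" using X_iff[OF *(1)] by blast
            then have "leaf b" using t_leaf b'' by blast
            then show False using \<open>a'' \<noteq> a\<close> ab *(1) b'' unfolding leaf_def by blast
          next
            case False
            then have "{a'', b''} \<in> K" using h_K[OF *(1)] * s by metis
            then show False using K_iff[OF *(1)] out b'' by blast
          qed
        qed
        then have "s {a, b''} = Some x" using h_K[OF *(1)] * out by auto
        then have "{a, b''} = {a, b'}" using e'_uniq b' by blast
        then show "a'' = a \<and> b'' = b'" using \<open>a'' = a\<close> by (auto simp: doubleton_eq_iff)
      qed auto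
    qed
  qed
qed

section \<open>Breadth-first forests\<close>

text \<open>A non-isolated edge shares an end with another edge, so its component has a vertex with
  two neighbours to serve as root. \<open>W\<close> is the union of these components,
  \<open>d\<close> the distance from the root, and \<open>y\<close>, \<open>z\<close> pick two
  neighbours of each root.\<close>

lemma bfs_forest:
  fixes E :: "'a set set"
  assumes card2: "\<forall>e\<in>E. card e = 2"
  obtains W :: "'a set" and rt par y z :: "'a \<Rightarrow> 'a" and d :: "'a \<Rightarrow> nat" where
    "\<And>e. e \<in> E \<Longrightarrow> \<not> isolated_edge E e \<Longrightarrow> e \<subseteq> W"
    "\<And>u v. {u, v} \<in> E \<Longrightarrow> u \<in> W \<Longrightarrow> v \<in> W \<and> rt v = rt u \<and> d v \<le> Suc (d u)"
    "\<And>v. v \<in> W \<Longrightarrow> d v > 0 \<Longrightarrow> {v, par v} \<in> E \<and> d v = Suc (d (par v))"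
    "\<And>v. v \<in> W \<Longrightarrow> d v = 0 \<longleftrightarrow> v = rt v"
    "\<And>v. v \<in> W \<Longrightarrow> y (rt v) \<noteq> z (rt v) \<and> {rt v, y (rt v)} \<in> E \<and> {rt v, z (rt v)} \<in> E"
proof -
  define R where "R = {(u, v). {u, v} \<in> E}"
  have "sym R" unfolding R_def sym_def by (auto simp: insert_commute)
  then have sym: "sym (R\<^sup>*)" by (rule sym_rtrancl)
  define fork where "fork r \<longleftrightarrow> (\<exists>a b. a \<noteq> b \<and> {r, a} \<in> E \<and> {r, b} \<in> E)" for r
  define W where "W = {v. \<exists>r. (v, r) \<in> R\<^sup>* \<and> fork r}"
  define rt where "rt v = (SOME r. (v, r) \<in> R\<^sup>* \<and> fork r)" for v
  define d where "d v = (LEAST n. (rt v, v) \<in> R ^^ n)" for v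
  define par where "par v = (SOME p. {v, p} \<in> E \<and> d v = Suc (d p))" for v
  define y where "y r = (SOME a. \<exists>b. a \<noteq> b \<and> {r, a} \<in> E \<and> {r, b} \<in> E)" for r
  define z where "z r = (SOME b. y r \<noteq> b \<and> {r, y r} \<in> E \<and> {r, b} \<in> E)" for r
  have rt: "(v, rt v) \<in> R\<^sup>* \<and> fork (rt v)" if "v \<in> W" for v
    unfolding rt_def by (rule someI_ex) (use that W_def in blast)
  have dist: "(rt v, v) \<in> R ^^ d v" if "v \<in> W" for v
  proof -
    have "(rt v, v) \<in> R\<^sup>*" using rt[OF that] sym by (blast dest: symD)
    then obtain n where "(rt v, v) \<in> R ^^ n" using rtrancl_imp_relpow by blast
    then show ?thesis unfolding d_def by (rule LeastI)
  qed
  have dist_le: "d v \<le> n" if "(rt v, v) \<in> R ^^ n" for v n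
    unfolding d_def using that by (rule Least_le)
  have step: "v \<in> W \<and> rt v = rt u \<and> d v \<le> Suc (d u)" if "{u, v} \<in> E" "u \<in> W" for u v
  proof -
    have uv: "(u, v) \<in> R" using that unfolding R_def by blast
    then have vu: "(v, u) \<in> R" using \<open>sym R\<close> by (blast dest: symD)
    \<comment> \<open>Adjacent vertices reach the same vertices, so the choice operator picks the
      same root for both.\<close>
    have reach: "(v, r) \<in> R\<^sup>* \<longleftrightarrow> (u, r) \<in> R\<^sup>*" for r
      using uv vu by (meson converse_rtrancl_into_rtrancl)
    then have eq: "rt v = rt u" unfolding rt_def by simp
    have "v \<in> W" using that(2) reach unfolding W_def by blast
    moreover have "(rt v, v) \<in> R ^^ Suc (d u)" using dist[OF that(2)] uv eq by auto
    ultimately show ?thesis using eq dist_le by blast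
  qed
  have parent: "{v, par v} \<in> E \<and> d v = Suc (d (par v))" if "v \<in> W" "d v > 0" for v
    unfolding par_def
  proof (rule someI_ex)
    \<comment> \<open>The parent is the vertex before \<open>v\<close> on a shortest walk from the
      root.\<close>
    obtain n where n: "d v = Suc n" using \<open>d v > 0\<close> gr0_implies_Suc by blast
    then obtain p where p: "(rt v, p) \<in> R ^^ n" "(p, v) \<in> R" using dist[OF \<open>v \<in> W\<close>] by auto
    then have vp: "{v, p} \<in> E" unfolding R_def by (simp add: insert_commute)
    have "p \<in> W" "rt p = rt v" using step[OF vp \<open>v \<in> W\<close>] by auto
    then have "d p \<le> n" using dist_le p by simp
    moreover have "d v \<le> Suc (d p)" using step[of p v] vp \<open>p \<in> W\<close> by (simp add: insert_commute)
    ultimately show "\<exists>p. {v, p} \<in> E \<and> d v = Suc (d p)" using vp n by fastforce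
  qed
  have root: "d v = 0 \<longleftrightarrow> v = rt v" if "v \<in> W" for v
    using dist[OF that] dist_le[of v 0] by auto
  have special: "y (rt v) \<noteq> z (rt v) \<and> {rt v, y (rt v)} \<in> E \<and> {rt v, z (rt v)} \<in> E" if "v \<in> W" for v
  proof -
    have "\<exists>b. y (rt v) \<noteq> b \<and> {rt v, y (rt v)} \<in> E \<and> {rt v, b} \<in> E"
      unfolding y_def by (rule someI_ex) (use rt[OF that] fork_def in blast)
    then show ?thesis unfolding z_def by (rule someI_ex)
  qed
  have nonisolated: "e \<subseteq> W" if "e \<in> E" "\<not> isolated_edge E e" for e
  proof -
    obtain e' where e': "e' \<in> E" "e' \<noteq> e" "e' \<inter> e \<noteq> {}"
      using \<open>\<not> isolated_edge E e\<close> by (rule not_isolated_edgeE)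
    then obtain u where u: "u \<in> e" "u \<in> e'" by blast
    obtain v where v: "e = {u, v}"
      using u card2 \<open>e \<in> E\<close> by (metis card_2_iff insert_commute insert_iff singletonD)
    obtain w where w: "e' = {u, w}"
      using u card2 \<open>e' \<in> E\<close> by (metis card_2_iff insert_commute insert_iff singletonD)
    have "v \<noteq> w" using e' v w by blast
    then have "fork u" using that(1) e'(1) v w unfolding fork_def by blast
    then have "u \<in> W" unfolding W_def by blast
    then show ?thesis using step[of u v] that(1) v by blast
  qed
  show thesis
    by (rule that[of W rt d par y z]) (fact nonisolated step parent root special)+
qed

text \<open>The parent edge of the upper end of an edge below the root is the only nearby one in its depth
  class; the parent edges of two adjacent vertices of equal depth are told apart by \<open>g\<close>.\<close>
lemma forest_colouring:
  fixes E :: "'a set set"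
  assumes card2: "\<forall>e\<in>E. card e = 2"
  obtains d :: "'a \<Rightarrow> nat" where
    "\<And>g :: 'a \<Rightarrow> nat. (\<forall>v. g v < 3) \<Longrightarrow> \<exists>c :: 'a set \<Rightarrow> nat option.
       (\<forall>e b. c e = Some b \<longrightarrow> b < 11) \<and>
       (\<forall>u v. c {u, v} \<noteq> None \<longrightarrow> d u \<noteq> d v) \<and>
       (\<forall>u v. {u, v} \<in> E \<longrightarrow> \<not> isolated_edge E {u, v} \<longrightarrow> d u \<noteq> d v \<or> g u \<noteq> g v
          \<longrightarrow> satisfied E c {u, v})"
proof -
  obtain W :: "'a set" and rt par y z :: "'a \<Rightarrow> 'a" and d :: "'a \<Rightarrow> nat" where
    W: "\<And>e. e \<in> E \<Longrightarrow> \<not> isolated_edge E e \<Longrightarrow> e \<subseteq> W"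
    and step: "\<And>u v. {u, v} \<in> E \<Longrightarrow> u \<in> W \<Longrightarrow> v \<in> W \<and> rt v = rt u \<and> d v \<le> Suc (d u)"
    and par: "\<And>v. v \<in> W \<Longrightarrow> d v > 0 \<Longrightarrow> {v, par v} \<in> E \<and> d v = Suc (d (par v))"
    and root: "\<And>v. v \<in> W \<Longrightarrow> d v = 0 \<longleftrightarrow> v = rt v"
    and special: "\<And>v. v \<in> W \<Longrightarrow> y (rt v) \<noteq> z (rt v) \<and> {rt v, y (rt v)} \<in> E \<and> {rt v, z (rt v)} \<in> E"
    by (rule bfs_forest[OF card2]) (rule that)
  have par_W: "par v \<in> W \<and> rt (par v) = rt v" if "v \<in> W" "d v > 0" for v
    using par[OF that] step that(1) by blast
  show thesis
  proof (rule that[of d])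
    \<comment> \<open>The depth does not depend on \<open>g\<close>, so labels can be chosen later
      for the edges whose ends have equal depth.\<close>
    fix g :: "'a \<Rightarrow> nat"
    assume g: "\<forall>v. g v < 3"
    \<comment> \<open>An edge at the root has no parent edge at its upper end; the colours
      \<open>9\<close> and \<open>10\<close> of two marked root edges replace it.\<close>
    define col where "col v = (if v = y (rt v) then 9 else if v = z (rt v) then 10
      else 3 * (d v mod 3) + g v)" for v
    define up where "up v e \<longleftrightarrow> v \<in> W \<and> d v > 0 \<and> e = {v, par v}" for v e
    define c where "c e = (if \<exists>v. up v e then Some (col (SOME v. up v e)) else None)" for e
    \<comment> \<open>If \<open>v\<close> and \<open>w\<close> were parents of each other, each
      would be deeper than the other.\<close>
    have up_unique: "v = w" if "up v e" "up w e" for v w e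
    proof (rule ccontr)
      assume "v \<noteq> w"
      with that have "v = par w" "w = par v" unfolding up_def by (auto simp: doubleton_eq_iff)
      moreover have "d v = Suc (d (par v))" "d w = Suc (d (par w))"
        using that par unfolding up_def by blast+
      ultimately show False by simp
    qed
    have c_up: "c e = Some (col v)" if "up v e" for v e
      using that up_unique[OF that someI[of "\<lambda>v. up v e"]] unfolding c_def by auto
    have c_Some: "\<exists>v. up v e \<and> b = col v" if "c e = Some b" for e b
      using that someI_ex[of "\<lambda>v. up v e"] unfolding c_def by (auto split: if_splits)
    have col_less: "3 * (d v mod 3) + g v < 9" for v
      using g[rule_format, of v] mod_less_divisor[of 3 "d v"] by linarith
    have col_eq: "v = w \<or> (d v mod 3 = d w mod 3 \<and> g v = g w)" if "col v = col w" "rt v = rt w" for v w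
    proof -
      have "v = w \<or> 3 * (d v mod 3) + g v = 3 * (d w mod 3) + g w"
        using that col_less[of v] col_less[of w] unfolding col_def by (auto split: if_splits)
      moreover have "a = b \<and> i = j" if "3 * a + i = 3 * b + j" "i < 3" "j < 3" for a b i j :: nat
        using that by presburger
      ultimately show ?thesis using g by blast
    qed
    have sat: "satisfied E c {u, v}"
      if "{u, v} \<in> E" "u \<in> W" "up x e'" "e' \<noteq> {u, v}" "e' \<inter> {u, v} \<noteq> {}"
        and uniq: "\<And>w. w \<in> W \<Longrightarrow> d w > 0 \<Longrightarrow> rt w = rt u \<Longrightarrow> w \<in> {u, v} \<or> par w \<in> {u, v} \<Longrightarrow>
          col w = col x \<Longrightarrow> w = x"
      for u v x e'
    proof (rule satisfiedI)
      show "e' \<in> E" using that(3) par unfolding up_def by blast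
      show "c e' = Some (col x)" using c_up that(3) .
      fix e'' assume e'': "e'' \<in> E" "e'' \<inter> {u, v} \<noteq> {}" "c e'' = Some (col x)"
      then obtain w where w: "up w e''" "col w = col x" using c_Some by metis
      then have mem: "w \<in> W" "d w > 0" "w \<in> {u, v} \<or> par w \<in> {u, v}"
        using e''(2) unfolding up_def by auto
      moreover have "rt w = rt u" using mem par_W[of w] step[OF that(1,2)] by auto
      ultimately have "w = x" using uniq w(2) by blast
      then show "e'' = e'" using w(1) that(3) unfolding up_def by simp
    qed fact+
    have sat_down: "satisfied E c {u, v}" if "{u, v} \<in> E" "u \<in> W" "d v = Suc (d u)" for u v
    proof (cases "d u = 0")
      case True
      then have r: "u = rt u" using root that(2) by blast
      have child: "w \<in> W \<and> rt w = u \<and> d w = 1 \<and> par w = u" if "{u, w} \<in> E" for w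
      proof -
        have w: "w \<in> W" "rt w = rt u" "d w \<le> 1" using step[OF that \<open>u \<in> W\<close>] True by auto
        have "w \<noteq> u" using that card2 by fastforce
        then have "d w \<noteq> 0" using root[OF w(1)] w(2) r by simp
        then have "d w = 1" using w by simp
        moreover from this have "d (par w) = 0" using par[OF w(1)] by simp
        then have "par w = u" using root[of "par w"] par_W[OF w(1)] \<open>d w = 1\<close> w(2) r by simp
        ultimately show ?thesis using w r by simp
      qed
      have ends: "y u \<noteq> z u" "{u, y u} \<in> E" "{u, z u} \<in> E" using special[OF that(2)] r by auto
      show ?thesis
      \<comment> \<open>Colour \<open>9\<close> occurs once in the component and serves every root
        edge but its own; that one uses colour \<open>10\<close>.\<close>
      proof (cases "v = y u")
        case False
        show ?thesis
        proof (rule sat[of u v "y u" "{y u, u}"])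
          show "up (y u) {y u, u}" using child[OF ends(2)] unfolding up_def by auto
          show "{y u, u} \<noteq> {u, v}" using False by (auto simp: doubleton_eq_iff)
          fix w assume "rt w = rt u" "col w = col (y u)"
          then show "w = y u"
            using r child[OF ends(2)] col_less[of w] unfolding col_def by (auto split: if_splits)
        qed (use that in auto)
      next
        case True
        show ?thesis
        proof (rule sat[of u v "z u" "{z u, u}"])
          show "up (z u) {z u, u}" using child[OF ends(3)] unfolding up_def by auto
          show "{z u, u} \<noteq> {u, v}" using True ends(1) by (auto simp: doubleton_eq_iff)
          fix w assume "rt w = rt u" "col w = col (z u)"
          then show "w = z u"
            using r child[OF ends(3)] ends(1) col_less[of w] unfolding col_def by (auto split: if_splits)
        qed (use that in auto)
      qed
    next
      case False
      then have pos: "d u > 0" by simp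
      show ?thesis
      proof (rule sat[of u v u "{u, par u}"])
        show "up u {u, par u}" using that(2) pos unfolding up_def by blast
        have "d (par u) \<noteq> d v" using par[OF that(2) pos] that(3) by linarith
        then show "{u, par u} \<noteq> {u, v}" by (auto simp: doubleton_eq_iff)
        \<comment> \<open>Nearby tree edges have lower ends at depth \<open>d u\<close>,
          \<open>d u + 1\<close> or \<open>d u + 2\<close>, distinct modulo 3, and \<open>u\<close>
          is the only one at depth \<open>d u\<close>.\<close>
        fix w assume w: "w \<in> W" "d w > 0" "rt w = rt u" "w \<in> {u, v} \<or> par w \<in> {u, v}" "col w = col u"
        have "w = u \<or> d w mod 3 = d u mod 3" using col_eq[OF w(5,3)] by blast
        moreover have "w = u \<or> d w = Suc (d u) \<or> d w = Suc (Suc (d u))"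
          using w(4) that(3) par[OF w(1,2)] by (metis insertE singletonD)
        moreover have "Suc (d u) mod 3 \<noteq> d u mod 3" "Suc (Suc (d u)) mod 3 \<noteq> d u mod 3"
          by presburger+
        ultimately show "w = u" by metis
      qed (use that in auto)
    qed
    have sat_flat: "satisfied E c {u, v}" if "{u, v} \<in> E" "u \<in> W" "d v = d u" "g u \<noteq> g v" for u v
    proof -
      have v: "v \<in> W" "rt v = rt u" using step[OF that(1,2)] by auto
      \<comment> \<open>At depth \<open>0\<close> both ends would be the root and have the same
        label.\<close>
      have "d u \<noteq> 0" using root[OF that(2)] root[OF v(1)] v(2) that(3,4) by metis
      then have pos: "d u > 0" by simp
      show ?thesis
      proof (rule sat[of u v u "{u, par u}"])
        show "up u {u, par u}" using that(2) pos unfolding up_def by blast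
        have "d (par u) \<noteq> d v" using par[OF that(2) pos] that(3) by linarith
        then show "{u, par u} \<noteq> {u, v}" by (auto simp: doubleton_eq_iff)
        \<comment> \<open>Besides \<open>u\<close>, only \<open>v\<close> lies at this depth, with
          another label; all other lower ends are one deeper.\<close>
        fix w assume w: "w \<in> W" "d w > 0" "rt w = rt u" "w \<in> {u, v} \<or> par w \<in> {u, v}" "col w = col u"
        have "w = u \<or> (d w mod 3 = d u mod 3 \<and> g w = g u)" using col_eq[OF w(5,3)] by blast
        moreover have "w = u \<or> w = v \<or> d w = Suc (d u)"
          using w(4) that(3) par[OF w(1,2)] by (metis insertE singletonD)
        moreover have "Suc (d u) mod 3 \<noteq> d u mod 3" by presburger
        ultimately show "w = u" using that(4) by metis
      qed (use that in auto)
    qed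
    show "\<exists>c :: 'a set \<Rightarrow> nat option.
       (\<forall>e b. c e = Some b \<longrightarrow> b < 11) \<and>
       (\<forall>u v. c {u, v} \<noteq> None \<longrightarrow> d u \<noteq> d v) \<and>
       (\<forall>u v. {u, v} \<in> E \<longrightarrow> \<not> isolated_edge E {u, v} \<longrightarrow> d u \<noteq> d v \<or> g u \<noteq> g v
          \<longrightarrow> satisfied E c {u, v})"
    proof (intro exI[of _ c] conjI allI impI)
      fix e b assume "c e = Some b"
      then obtain v where "b = col v" using c_Some by blast
      then show "b < 11" using col_less[of v] unfolding col_def by auto
    next
      fix u v assume "c {u, v} \<noteq> None"
      then obtain w where "up w {u, v}" using c_Some by blast
      then have "w \<in> W" "d w > 0" "{u, v} = {w, par w}" unfolding up_def by auto
      then show "d u \<noteq> d v" using par[of w] by (auto simp: doubleton_eq_iff)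
    next
      fix u v assume uv: "{u, v} \<in> E" "\<not> isolated_edge E {u, v}" "d u \<noteq> d v \<or> g u \<noteq> g v"
      have vu: "{v, u} \<in> E" "{v, u} = {u, v}" using uv(1) by (auto simp: insert_commute)
      have "u \<in> W" "v \<in> W" using W[OF uv(1,2)] by auto
      then have "d v \<le> Suc (d u)" "d u \<le> Suc (d v)" using step uv(1) vu(1) by blast+
      then consider "d v = Suc (d u)" | "d u = Suc (d v)" | "d v = d u" by linarith
      then show "satisfied E c {u, v}"
      proof cases
        case 1
        then show ?thesis using sat_down uv(1) \<open>u \<in> W\<close> by blast
      next
        case 2
        then show ?thesis using sat_down[OF vu(1) \<open>v \<in> W\<close>] vu(2) by simp
      next
        case 3
        then show ?thesis using sat_flat uv \<open>u \<in> W\<close> by metis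
      qed
    qed
  qed
qed

section \<open>Splitting edges by the highest differing bit\<close>

text \<open>One plus the position of the highest bit in which the two numbers differ, and
  \<open>0\<close> if they are equal.\<close>

definition diff_level :: "nat \<Rightarrow> nat \<Rightarrow> nat" where
  "diff_level x y = (LEAST q. x div 2 ^ q = y div 2 ^ q)"

lemma diff_level_le_iff: "diff_level x y \<le> q \<longleftrightarrow> x div 2 ^ q = y div 2 ^ q"
proof
  \<comment> \<open>Shifting by \<open>x + y\<close> sends both numbers to \<open>0\<close>, so the
    least value is attained.\<close>
  have "x < 2 ^ (x + y)" "y < 2 ^ (x + y)"
    by (meson le_add1 le_add2 less_exp order_le_less_trans)+
  then have "x div 2 ^ (x + y) = y div 2 ^ (x + y)" by simp
  then have *: "x div 2 ^ diff_level x y = y div 2 ^ diff_level x y"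
    unfolding diff_level_def by (rule LeastI)
  assume "diff_level x y \<le> q"
  then obtain r where "q = diff_level x y + r" using le_Suc_ex by blast
  then show "x div 2 ^ q = y div 2 ^ q" using * by (simp add: power_add div_mult2_eq)
next
  assume "x div 2 ^ q = y div 2 ^ q"
  then show "diff_level x y \<le> q" unfolding diff_level_def by (rule Least_le)
qed

lemma diff_level_commute: "diff_level x y = diff_level y x"
  unfolding diff_level_def by metis

lemma diff_level_eq_0_iff [simp]: "diff_level x y = 0 \<longleftrightarrow> x = y"
  using diff_level_le_iff[of x y 0] by simp

lemma diff_level_self [simp]: "diff_level x x = 0"
  by simp

lemma diff_level_ultrametric: "diff_level x z \<le> max (diff_level x y) (diff_level y z)"
  by (metis diff_level_le_iff max.cobounded1 max.cobounded2)

text \<open>In an ultrametric the two longest sides of a triangle are equal.\<close>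

lemma diff_level_replace:
  assumes "diff_level x y < diff_level x z"
  shows "diff_level y z = diff_level x z"
  using diff_level_ultrametric[of y z x] diff_level_ultrametric[of x z y] assms
    diff_level_commute[of x y] by linarith

text \<open>Shifting by \<open>p\<close> makes the highest differing bit the last one; its parity
  later gives the two sides of a bipartite level.\<close>

lemma diff_level_parity:
  assumes "diff_level x y = Suc p"
  shows "even (x div 2 ^ p) \<noteq> even (y div 2 ^ p)"
proof -
  have "x div 2 ^ p \<noteq> y div 2 ^ p" using assms diff_level_le_iff[of x y p] by simp
  moreover have "x div 2 ^ p div 2 = y div 2 ^ p div 2"
    using assms diff_level_le_iff[of x y "Suc p"] by (simp add: power_Suc2 div_mult2_eq del: power_Suc)
  ultimately show ?thesis by (metis dvd_mult_div_cancel odd_two_times_div_two_succ)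
qed

text \<open>The symmetric sum avoids choosing an order of the ends; halving undoes the double count,
  and the diagonal contributes \<open>0\<close>.\<close>

definition edge_level :: "('a \<Rightarrow> nat) \<Rightarrow> 'a set \<Rightarrow> nat" where
  "edge_level f e = (\<Sum>x\<in>e. \<Sum>y\<in>e. diff_level (f x) (f y)) div 2"

lemma edge_level_insert [simp]: "edge_level f {u, v} = diff_level (f u) (f v)"
  by (cases "u = v") (auto simp: edge_level_def diff_level_commute)

text \<open>If \<open>v\<close> is the only neighbour of \<open>u\<close> on the level \<open>q\<close> of \<open>uv\<close>, then \<open>u\<close> may be recoloured to
  \<open>f v\<close> with its last bit flipped. This lifts all lower edges at \<open>u\<close> to level \<open>q\<close>, so for a colouring
  maximising the sum of the \<open>2 ^ edge_level f e\<close> there is at most one of them.\<close>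
lemma maximal_colouring:
  fixes E :: "'a set set"
  assumes "simple_graph V E" and "colourable V E (2 ^ k)"
  obtains f :: "'a \<Rightarrow> nat" where
    "\<And>v. v \<in> V \<Longrightarrow> f v < 2 ^ k"
    "\<And>u v. {u, v} \<in> E \<Longrightarrow> f u \<noteq> f v"
    "\<And>u v w w'. {u, v} \<in> E \<Longrightarrow>
      \<forall>x. {u, x} \<in> E \<longrightarrow> diff_level (f u) (f x) = diff_level (f u) (f v) \<longrightarrow> x = v \<Longrightarrow>
      {u, w} \<in> E \<Longrightarrow> {u, w'} \<in> E \<Longrightarrow>
      diff_level (f u) (f w) < diff_level (f u) (f v) \<Longrightarrow>
      diff_level (f u) (f w') < diff_level (f u) (f v) \<Longrightarrow> w = w'"
proof -
  have finV: "finite V" and edge: "\<And>e. e \<in> E \<Longrightarrow> e \<subseteq> V \<and> card e = 2"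
    using assms(1) unfolding simple_graph_def by auto
  have "E \<subseteq> Pow V" using edge by blast
  then have finE: "finite E" using finV by (meson finite_Pow_iff finite_subset)
  have edge_pair: "\<exists>u v. e = {u, v} \<and> u \<in> V \<and> v \<in> V" if "e \<in> E" for e
    using edge[OF that] by (auto simp: card_2_iff)
  define good where "good f \<longleftrightarrow> (\<forall>v\<in>V. f v < 2 ^ k) \<and> (\<forall>u v. {u, v} \<in> E \<longrightarrow> f u \<noteq> f v)"
    for f :: "'a \<Rightarrow> nat"
  define weight where "weight f = (\<Sum>e\<in>E. 2 ^ edge_level f e :: nat)" for f :: "'a \<Rightarrow> nat"
  obtain f0 where f0: "good f0" using assms(2) unfolding colourable_def good_def by blast
  \<comment> \<open>Levels are at most \<open>k\<close>, so the weights are bounded and a heaviest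
    colouring exists.\<close>
  have "weight f < Suc (card E * 2 ^ k)" if "good f" for f
  proof -
    have "2 ^ edge_level f e \<le> (2 ^ k :: nat)" if "e \<in> E" for e
    proof -
      obtain u v where "e = {u, v}" "u \<in> V" "v \<in> V" using edge_pair \<open>e \<in> E\<close> by blast
      then have "edge_level f e \<le> k" using \<open>good f\<close> by (simp add: diff_level_le_iff good_def)
      then show ?thesis by simp
    qed
    then have "weight f \<le> (\<Sum>e\<in>E. 2 ^ k)" unfolding weight_def by (rule sum_mono)
    then show ?thesis by simp
  qed
  then obtain f where f: "good f" and max: "\<And>f'. good f' \<Longrightarrow> weight f' \<le> weight f"
    using ex_has_greatest_nat[of good f0 weight] f0 by blast
  show thesis
  proof (rule that[of f])
    fix u v w w'
    assume uv: "{u, v} \<in> E"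
      and only: "\<forall>x. {u, x} \<in> E \<longrightarrow> diff_level (f u) (f x) = diff_level (f u) (f v) \<longrightarrow> x = v"
      and uw: "{u, w} \<in> E" and uw': "{u, w'} \<in> E"
      and low: "diff_level (f u) (f w) < diff_level (f u) (f v)"
        "diff_level (f u) (f w') < diff_level (f u) (f v)"
    show "w = w'"
    proof (rule ccontr)
      assume "w \<noteq> w'"
      define q where "q = diff_level (f u) (f v)"
      define x where "x = (if even (f v) then f v + 1 else f v - 1)"
      have x: "x div 2 = f v div 2" "x \<noteq> f v"
        unfolding x_def by (auto elim!: oddE)
      have "diff_level x (f v) \<noteq> 0" using x by simp
      moreover have "diff_level x (f v) \<le> 1" using x by (simp add: diff_level_le_iff)
      ultimately have x_v: "diff_level x (f v) = 1" by linarith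
      \<comment> \<open>The level of \<open>{u, w}\<close> is positive and below \<open>q\<close>,
        so \<open>q > 1\<close>; flipping the last bit of \<open>f v\<close> then keeps it at level
        \<open>q\<close> from \<open>f u\<close>.\<close>
      have "diff_level (f u) (f w) \<noteq> 0" using f uw unfolding good_def by simp
      then have q: "q > 1" using low unfolding q_def by linarith
      have u_x: "diff_level (f u) x = q"
        using diff_level_replace[of "f v" x "f u"] x_v q diff_level_commute
        unfolding q_def by metis
      have neq: "t \<noteq> u" if "{u, t} \<in> E" for t
        using edge[OF that] by auto
      have u_V: "u \<in> V" "v \<in> V" using edge[OF uv] by auto
      have q_k: "q \<le> k" using f u_V unfolding q_def good_def by (simp add: diff_level_le_iff)
      define f' where "f' = f(u := x)"
      \<comment> \<open>The edge to \<open>v\<close> drops to level \<open>1\<close>, lower edges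
        rise to \<open>q\<close>, and higher ones stay, by the ultrametric law.\<close>
      have lev: "diff_level x (f t) =
          (if t = v then 1 else if diff_level (f u) (f t) < q then q else diff_level (f u) (f t))"
        if "{u, t} \<in> E" for t
      proof (cases "t = v")
        case False
        then have "diff_level (f u) (f t) \<noteq> q" using only that unfolding q_def by blast
        then consider "diff_level (f u) (f t) < q" | "diff_level (f u) (f t) > q" by linarith
        then show ?thesis
        proof cases
          case 1
          then show ?thesis
            using False u_x diff_level_replace[of "f u" "f t" x] by (simp add: diff_level_commute)
        next
          case 2
          then show ?thesis
            using False u_x diff_level_replace[of "f u" x "f t"] by simp
        qed
      qed (simp add: x_v)
      have "good f'"
        unfolding good_def
      proof (intro conjI ballI allI impI)
        fix t assume "t \<in> V"
        have "x div 2 ^ k = f v div 2 ^ k"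
          using diff_level_le_iff[of x "f v" k] x_v q q_k by simp
        moreover have "f v < 2 ^ k" using f u_V unfolding good_def by blast
        ultimately have "x < 2 ^ k" by (simp add: div_eq_0_iff)
        then show "f' t < 2 ^ k" using f \<open>t \<in> V\<close> unfolding f'_def good_def by simp
      next
        fix s t assume st: "{s, t} \<in> E"
        have new: "x \<noteq> f t" if "{u, t} \<in> E" for t
        proof -
          have "diff_level (f u) (f t) \<noteq> 0" using f that unfolding good_def by simp
          then have "diff_level x (f t) \<noteq> 0" using lev[OF that] q by auto
          then show ?thesis by simp
        qed
        show "f' s \<noteq> f' t"
        proof (cases "s = u \<or> t = u")
          case True
          then show ?thesis
            using new[of s] new[of t] neq[of s] neq[of t] st unfolding f'_def
            by (auto simp: insert_commute)
        next
          case False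
          then show ?thesis using f st unfolding f'_def good_def by simp
        qed
      qed
      then have le: "weight f' \<le> weight f" by (rule max)
      define N where "N = {t. {u, t} \<in> E}"
      define old where "old t = (2 ^ diff_level (f u) (f t) :: nat)" for t
      define new where "new t = (2 ^ diff_level x (f t) :: nat)" for t
      have "N \<subseteq> V" unfolding N_def using edge by blast
      then have finN: "finite N" using finV by (rule finite_subset)
      have star: "{e \<in> E. u \<in> e} = (\<lambda>t. {u, t}) ` N"
      proof (intro equalityI subsetI)
        fix e assume "e \<in> {e \<in> E. u \<in> e}"
        then have "e \<in> E" "u \<in> e" by auto
        moreover obtain a b where "e = {a, b}" using edge_pair[OF \<open>e \<in> E\<close>] by blast
        ultimately have "\<exists>t. e = {u, t}" by (auto simp: insert_commute)
        then show "e \<in> (\<lambda>t. {u, t}) ` N" using \<open>e \<in> E\<close> unfolding N_def by blast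
      qed (auto simp: N_def)
      have inj: "inj_on (\<lambda>t. {u, t}) N" by (auto simp: inj_on_def doubleton_eq_iff)
      have split: "weight h = (\<Sum>e\<in>{e \<in> E. u \<notin> e}. 2 ^ edge_level h e) + (\<Sum>t\<in>N. 2 ^ diff_level (h u) (h t))" for h
      proof -
        have "weight h = (\<Sum>e\<in>{e \<in> E. u \<notin> e}. 2 ^ edge_level h e) + (\<Sum>e\<in>{e \<in> E. u \<in> e}. 2 ^ edge_level h e)"
          unfolding weight_def using finE
          by (subst sum.union_disjoint[symmetric]) (auto intro!: sum.cong)
        also have "(\<Sum>e\<in>{e \<in> E. u \<in> e}. 2 ^ edge_level h e) = (\<Sum>t\<in>N. (2::nat) ^ diff_level (h u) (h t))"
          unfolding star by (subst sum.reindex[OF inj]) simp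
        finally show ?thesis .
      qed
      have "(\<Sum>e\<in>{e \<in> E. u \<notin> e}. (2::nat) ^ edge_level f' e) = (\<Sum>e\<in>{e \<in> E. u \<notin> e}. 2 ^ edge_level f e)"
      proof (rule sum.cong)
        fix e assume "e \<in> {e \<in> E. u \<notin> e}"
        then have "edge_level f' e = edge_level f e"
          unfolding edge_level_def f'_def by (intro arg_cong[where f = "\<lambda>n. n div 2"] sum.cong) auto
        then show "(2::nat) ^ edge_level f' e = 2 ^ edge_level f e" by simp
      qed simp
      moreover have "(\<Sum>t\<in>N. (2::nat) ^ diff_level (f' u) (f' t)) = (\<Sum>t\<in>N. new t)"
        unfolding f'_def new_def N_def using neq by (intro sum.cong) auto
      ultimately have sum_le: "(\<Sum>t\<in>N. new t) \<le> (\<Sum>t\<in>N. old t)"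
        using le split[of f] split[of f'] unfolding old_def by simp
      have sub: "{v, w, w'} \<subseteq> N" using uv uw uw' unfolding N_def by blast
      have distinct: "v \<noteq> w" "v \<noteq> w'" using low by auto
      have sums: "(\<Sum>t\<in>N. h t) = (\<Sum>t\<in>N - {v, w, w'}. h t) + (h v + h w + h w')" for h :: "'a \<Rightarrow> nat"
        using sum.subset_diff[OF sub finN, of h] distinct \<open>w \<noteq> w'\<close> by simp
      have "(\<Sum>t\<in>N - {v, w, w'}. old t) \<le> (\<Sum>t\<in>N - {v, w, w'}. new t)"
      proof (rule sum_mono)
        fix t assume "t \<in> N - {v, w, w'}"
        then have "{u, t} \<in> E" "t \<noteq> v" unfolding N_def by auto
        then have "diff_level (f u) (f t) \<le> diff_level x (f t)" using lev by simp
        then show "old t \<le> new t" unfolding old_def new_def by simp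
      qed
      \<comment> \<open>On the three edges the old total is at most \<open>2 ^ q + 2 ^ q\<close>,
        since the two low edges count at most half of \<open>2 ^ q\<close> each; the new total is
        larger by at least \<open>2\<close>.\<close>
      moreover have "new v = 2" "new w = 2 ^ q" "new w' = 2 ^ q" "old v = 2 ^ q"
        using lev[OF uv] lev[OF uw] lev[OF uw'] low distinct unfolding new_def old_def q_def by auto
      moreover have half: "2 * old t \<le> 2 ^ q" if "diff_level (f u) (f t) < q" for t
        using that power_increasing[of "Suc (diff_level (f u) (f t))" q "2::nat"] unfolding old_def by simp
      have "2 * old w \<le> 2 ^ q" "2 * old w' \<le> 2 ^ q" using half low unfolding q_def by auto
      ultimately show False using sum_le sums[of old] sums[of new] by linarith
    qed
  qed (use f good_def in blast)+
qed

text \<open>Greedy colouring: each added vertex has at most two neighbours in \<open>L\<close>, so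
  one of three labels is free.\<close>

lemma degree_two_colouring:
  fixes L :: "'a set set"
  assumes "finite V" and "\<forall>e\<in>L. card e = 2"
    and deg: "\<And>u a b c. {u, a} \<in> L \<Longrightarrow> {u, b} \<in> L \<Longrightarrow> {u, c} \<in> L \<Longrightarrow> a = b \<or> a = c \<or> b = c"
  obtains g :: "'a \<Rightarrow> nat" where "\<forall>v. g v < 3" "\<And>u v. {u, v} \<in> L \<Longrightarrow> u \<in> V \<Longrightarrow> v \<in> V \<Longrightarrow> g u \<noteq> g v"
proof -
  have "\<exists>g :: 'a \<Rightarrow> nat. (\<forall>v. g v < 3) \<and> (\<forall>u\<in>V. \<forall>v\<in>V. {u, v} \<in> L \<longrightarrow> g u \<noteq> g v)"
    using assms(1)
  proof (induction V rule: finite_induct)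
    case empty
    show ?case by (rule exI[of _ "\<lambda>_. 0"]) simp
  next
    case (insert x V)
    then obtain g :: "'a \<Rightarrow> nat" where g: "\<forall>v. g v < 3" "\<forall>u\<in>V. \<forall>v\<in>V. {u, v} \<in> L \<longrightarrow> g u \<noteq> g v"
      by blast
    have "\<exists>j<3. \<forall>t. {x, t} \<in> L \<longrightarrow> g t \<noteq> j"
    proof (rule ccontr)
      assume "\<not> ?thesis"
      then have all: "\<exists>t. {x, t} \<in> L \<and> g t = j" if "j < 3" for j using that by blast
      obtain a where a: "{x, a} \<in> L" "g a = 0" using all[of 0] by auto
      obtain b where b: "{x, b} \<in> L" "g b = 1" using all[of 1] by auto
      obtain c where c: "{x, c} \<in> L" "g c = 2" using all[of 2] by auto
      show False using deg[OF a(1) b(1) c(1)] a b c by auto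
    qed
    then obtain j where j: "j < 3" "\<forall>t. {x, t} \<in> L \<longrightarrow> g t \<noteq> j" by blast
    have loop: "{x, x} \<notin> L" using assms(2) by force
    define g' where "g' = g(x := j)"
    have "g' u \<noteq> g' v" if uv: "{u, v} \<in> L" "u \<in> insert x V" "v \<in> insert x V" for u v
    proof -
      have vu: "{v, u} \<in> L" using uv(1) by (simp add: insert_commute)
      show ?thesis
        using uv vu loop g(2) j(2) unfolding g'_def by (cases "u = x"; cases "v = x") auto
    qed
    moreover have "\<forall>v. g' v < 3" using g(1) j(1) unfolding g'_def by simp
    ultimately show ?case by blast
  qed
  then show thesis using that by blast
qed

section \<open>Combining the forest colouring with the colourings of the levels\<close>

theorem mainTheorem10:
  fixes V :: "'a set" and E :: "'a set set" and \<alpha> :: nat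
  assumes "\<alpha> \<ge> 1"
    and "simple_graph V E"
    and "colourable V E \<alpha>"
  shows "\<exists>c :: 'a set \<Rightarrow> nat option.
           (\<forall>e\<in>E. \<forall>b. c e = Some b \<longrightarrow> b < nat (3 * \<lceil>log 2 (real \<alpha>)\<rceil> + 16)) \<and>
           (\<forall>e\<in>E. \<not> isolated_edge E e \<longrightarrow> satisfied E c e)"
proof -
  define k where "k = nat \<lceil>log 2 (real \<alpha>)\<rceil>"
  have "log 2 (real \<alpha>) \<ge> 0" using assms(1) by simp
  then have "\<lceil>log 2 (real \<alpha>)\<rceil> \<ge> 0" by linarith
  then have k: "\<lceil>log 2 (real \<alpha>)\<rceil> = int k" unfolding k_def by simp
  then have bound: "nat (3 * \<lceil>log 2 (real \<alpha>)\<rceil> + 16) = 3 * k + 16" by simp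
  have "log 2 (real \<alpha>) \<le> real k" using k by (metis le_of_int_ceiling of_int_of_nat_eq)
  then have "real \<alpha> \<le> 2 ^ k"
    using assms(1) by (simp add: log_le_iff powr_realpow)
  then have \<alpha>_le: "\<alpha> \<le> 2 ^ k" by (metis of_nat_le_iff of_nat_numeral of_nat_power)
  have finV: "finite V" and edge: "\<And>e. e \<in> E \<Longrightarrow> e \<subseteq> V \<and> card e = 2"
    using assms(2) unfolding simple_graph_def by auto
  have card2: "\<forall>e\<in>E. card e = 2" using edge by blast
  obtain d :: "'a \<Rightarrow> nat" where forest: "\<And>g :: 'a \<Rightarrow> nat. (\<forall>v. g v < 3) \<Longrightarrow> \<exists>c :: 'a set \<Rightarrow> nat option.
       (\<forall>e b. c e = Some b \<longrightarrow> b < 11) \<and>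
       (\<forall>u v. c {u, v} \<noteq> None \<longrightarrow> d u \<noteq> d v) \<and>
       (\<forall>u v. {u, v} \<in> E \<longrightarrow> \<not> isolated_edge E {u, v} \<longrightarrow> d u \<noteq> d v \<or> g u \<noteq> g v
          \<longrightarrow> satisfied E c {u, v})"
    by (rule forest_colouring[OF card2]) (rule that)
  define F where "F = {e \<in> E. \<forall>u\<in>e. \<forall>v\<in>e. d u = d v}"
  have "F \<subseteq> E" unfolding F_def by blast
  have "simple_graph V F" using assms(2) \<open>F \<subseteq> E\<close> unfolding simple_graph_def by blast
  moreover have "colourable V F (2 ^ k)"
    using assms(3) \<alpha>_le \<open>F \<subseteq> E\<close> unfolding colourable_def by (meson order_less_le_trans subsetD)
  ultimately obtain f :: "'a \<Rightarrow> nat" where f_less: "\<And>v. v \<in> V \<Longrightarrow> f v < 2 ^ k"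
    and proper: "\<And>u v. {u, v} \<in> F \<Longrightarrow> f u \<noteq> f v"
    and low_edge: "\<And>u v w w'. {u, v} \<in> F \<Longrightarrow>
      \<forall>x. {u, x} \<in> F \<longrightarrow> diff_level (f u) (f x) = diff_level (f u) (f v) \<longrightarrow> x = v \<Longrightarrow>
      {u, w} \<in> F \<Longrightarrow> {u, w'} \<in> F \<Longrightarrow>
      diff_level (f u) (f w) < diff_level (f u) (f v) \<Longrightarrow>
      diff_level (f u) (f w') < diff_level (f u) (f v) \<Longrightarrow> w = w'"
    by (rule maximal_colouring) (rule that)
  define H where "H q = {e \<in> F. edge_level f e = q}" for q
  define L where "L = {e \<in> F. isolated_edge (H (edge_level f e)) e}"
  have finF: "finite F"
    using finV edge \<open>F \<subseteq> E\<close> by (metis Pow_iff finite_Pow_iff finite_subset subsetD subsetI)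
  \<comment> \<open>An edge isolated in its level is the only edge of that level at each of its
    ends.\<close>
  have only: "x = v" if "{u, v} \<in> L" "{u, x} \<in> F" "diff_level (f u) (f x) = diff_level (f u) (f v)" for u v x
  proof (rule ccontr)
    assume "x \<noteq> v"
    then have "{u, x} \<noteq> {u, v}" by (auto simp: doubleton_eq_iff)
    moreover have "{u, x} \<in> H (edge_level f {u, v})" using that unfolding H_def by simp
    ultimately show False
      using that(1) unfolding L_def isolated_edge_def open_edge_nbhd_def closed_edge_nbhd_def by blast
  qed
  have top: "b = c" if "{u, a} \<in> L" "{u, b} \<in> L" "{u, c} \<in> L" "a \<noteq> b" "a \<noteq> c"
    "diff_level (f u) (f b) \<le> diff_level (f u) (f a)" "diff_level (f u) (f c) \<le> diff_level (f u) (f a)"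
    for u a b c
  proof -
    have "{u, a} \<in> F" "{u, b} \<in> F" "{u, c} \<in> F" using that(1-3) unfolding L_def by auto
    moreover from this have "diff_level (f u) (f b) < diff_level (f u) (f a)"
      "diff_level (f u) (f c) < diff_level (f u) (f a)"
      using only[OF that(1)] that(4-7) by (metis nat_less_le)+
    ultimately show ?thesis using low_edge only[OF that(1)] by blast
  qed
  \<comment> \<open>Of three edges of \<open>L\<close> at \<open>u\<close> take one of highest
    level: the other two are strictly lower or equal to it, and maximality of \<open>f\<close>
    allows only one lower edge.\<close>
  have "a = b \<or> a = c \<or> b = c" if "{u, a} \<in> L" "{u, b} \<in> L" "{u, c} \<in> L" for u a b c
    using top[OF that(1,2,3)] top[OF that(2,1,3)] top[OF that(3,1,2)] by (metis nle_le order_trans)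
  moreover have "\<forall>e\<in>L. card e = 2" using card2 \<open>F \<subseteq> E\<close> unfolding L_def by blast
  ultimately obtain g :: "'a \<Rightarrow> nat" where g: "\<forall>v. g v < 3"
    and g_L: "\<And>u v. {u, v} \<in> L \<Longrightarrow> u \<in> V \<Longrightarrow> v \<in> V \<Longrightarrow> g u \<noteq> g v"
    using degree_two_colouring[OF finV, of L] by metis
  obtain c1 :: "'a set \<Rightarrow> nat option" where c1: "\<And>e b. c1 e = Some b \<Longrightarrow> b < 11"
    and c1_depth: "\<And>u v. c1 {u, v} \<noteq> None \<Longrightarrow> d u \<noteq> d v"
    and c1_sat: "\<And>u v. {u, v} \<in> E \<Longrightarrow> \<not> isolated_edge E {u, v} \<Longrightarrow> d u \<noteq> d v \<or> g u \<noteq> g v \<Longrightarrow>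
      satisfied E c1 {u, v}"
    using forest[OF g] by blast
  have F_pair: "\<exists>u v. e = {u, v} \<and> u \<in> V \<and> v \<in> V" if "e \<in> F" for e
    using edge[OF subsetD[OF \<open>F \<subseteq> E\<close> that]] by (auto simp: card_2_iff)
  have c1_F: "c1 e = None" if "e \<in> F" for e
    using F_pair[OF that] c1_depth that unfolding F_def by blast
  have level: "0 < edge_level f e \<and> edge_level f e \<le> k" if "e \<in> F" for e
  proof -
    obtain u v where e: "e = {u, v}" "u \<in> V" "v \<in> V" using F_pair[OF \<open>e \<in> F\<close>] by blast
    then have "f u \<noteq> f v" using proper that by blast
    then have "diff_level (f u) (f v) > 0" by (simp add: neq0_conv[symmetric] del: neq0_conv)
    then show ?thesis using e f_less by (simp add: diff_level_le_iff)
  qed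
  have "\<exists>h :: 'a set \<Rightarrow> nat option. (\<forall>e b. h e = Some b \<longrightarrow> e \<in> H q \<and> b < 3) \<and>
      (\<forall>e\<in>H q. \<not> isolated_edge (H q) e \<longrightarrow> satisfied (H q) h e)" for q
  proof -
    have "finite (H q)" using finF unfolding H_def by simp
    \<comment> \<open>Edges on level \<open>q\<close> join colours that differ in bit
      \<open>q - 1\<close>; levels of edges in \<open>F\<close> are positive, so the subtraction is
      exact.\<close>
    moreover have "\<forall>e\<in>H q. \<exists>a b. e = {a, b} \<and> even (f a div 2 ^ (q - 1)) \<and> \<not> even (f b div 2 ^ (q - 1))"
    proof
      fix e assume "e \<in> H q"
      then have eF: "e \<in> F" "edge_level f e = q" unfolding H_def by auto
      obtain u v where e: "e = {u, v}" using F_pair[OF eF(1)] by blast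
      have "diff_level (f u) (f v) = Suc (q - 1)" using e eF level[OF eF(1)] by simp
      from diff_level_parity[OF this]
      show "\<exists>a b. e = {a, b} \<and> even (f a div 2 ^ (q - 1)) \<and> \<not> even (f b div 2 ^ (q - 1))"
        using e by (metis insert_commute)
    qed
    ultimately obtain h :: "'a set \<Rightarrow> nat option" where
      "\<And>e b. h e = Some b \<Longrightarrow> e \<in> H q \<and> b < 3"
      "\<And>e. e \<in> H q \<Longrightarrow> \<not> isolated_edge (H q) e \<Longrightarrow> satisfied (H q) h e"
      by (rule bipartite_colouring) (rule that)
    then show ?thesis by blast
  qed
  then obtain h :: "nat \<Rightarrow> 'a set \<Rightarrow> nat option" where
    h: "\<And>q e b. h q e = Some b \<Longrightarrow> e \<in> H q \<and> b < 3"
    and h_sat: "\<And>q e. e \<in> H q \<Longrightarrow> \<not> isolated_edge (H q) e \<Longrightarrow> satisfied (H q) (h q) e"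
    by metis
  \<comment> \<open>Levels start at \<open>1\<close>, so with offset \<open>8\<close> the level
    colours start at \<open>11\<close>, just above those of \<open>c1\<close>, which leaves
    \<open>F\<close> uncoloured.\<close>
  define c where "c e = (if e \<in> F then map_option (\<lambda>b. 3 * edge_level f e + 8 + b) (h (edge_level f e) e)
    else c1 e)" for e
  have c_F: "\<exists>b. h (edge_level f e) e = Some b \<and> b < 3 \<and> x = 3 * edge_level f e + 8 + b"
    if "c e = Some x" "e \<in> F" for e x
    using that h unfolding c_def by auto
  have c_low: "c e = Some b \<longleftrightarrow> c1 e = Some b" if "b < 11" for e b
  proof (cases "e \<in> F")
    case True
    then show ?thesis using c_F[of e b] level[OF True] c1_F that by fastforce
  qed (simp add: c_def)
  have c_high: "c e = Some (3 * q + 8 + b) \<longleftrightarrow> h q e = Some b" if "b < 3" "q > 0" for e b q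
  proof
    assume ce: "c e = Some (3 * q + 8 + b)"
    then have "e \<in> F" using c_low c1 that(2) unfolding c_def by (fastforce split: if_splits)
    then obtain b' where "h (edge_level f e) e = Some b'" "b' < 3" "3 * q + b = 3 * edge_level f e + b'"
      using c_F[OF ce] by auto
    moreover from this have "q = edge_level f e" using that(1) by linarith
    ultimately show "h q e = Some b" by simp
  next
    assume "h q e = Some b"
    moreover from this have "e \<in> F" "edge_level f e = q" using h unfolding H_def by blast+
    ultimately show "c e = Some (3 * q + 8 + b)" unfolding c_def by simp
  qed
  show ?thesis
    unfolding bound
  proof (intro exI[of _ c] conjI ballI allI impI)
    fix e x assume "c e = Some x"
    show "x < 3 * k + 16"
    proof (cases "e \<in> F")
      case True
      then show ?thesis using c_F[OF \<open>c e = Some x\<close>] level[OF True] by fastforce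
    next
      case False
      then show ?thesis using c1[of e x] \<open>c e = Some x\<close> unfolding c_def by simp
    qed
  next
    fix e assume e: "e \<in> E" "\<not> isolated_edge E e"
    then obtain u v where uv: "e = {u, v}" "u \<in> V" "v \<in> V" using edge[OF e(1)] by (auto simp: card_2_iff)
    show "satisfied E c e"
    proof (cases "d u \<noteq> d v \<or> g u \<noteq> g v")
      case True
      then have "satisfied E c1 e" using c1_sat e uv by blast
      then obtain e' b where e': "e' \<in> E" "e' \<noteq> e" "e' \<inter> e \<noteq> {}" "c1 e' = Some b"
        and uniq: "\<And>e''. e'' \<in> E \<Longrightarrow> e'' \<inter> e \<noteq> {} \<Longrightarrow> c1 e'' = Some b \<Longrightarrow> e'' = e'"
        by (rule satisfiedE) (rule that)
      \<comment> \<open>Below \<open>11\<close> the colours of \<open>c\<close> are exactly those of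
        \<open>c1\<close>, so uniqueness carries over.\<close>
      note c_b = c_low[OF c1[OF e'(4)]]
      from e'(1-3) show ?thesis
      proof (rule satisfiedI)
        show "c e' = Some b" using c_b e'(4) by blast
        fix e'' assume "e'' \<in> E" "e'' \<inter> e \<noteq> {}" "c e'' = Some b"
        then show "e'' = e'" using c_b uniq by blast
      qed
    next
      case False
      define q where "q = edge_level f e"
      have "e \<in> F" using e uv False unfolding F_def by auto
      then have "e \<in> H q" "q > 0" using level unfolding H_def q_def by auto
      \<comment> \<open>Since \<open>g\<close> separates the ends of every edge of \<open>L\<close>,
        equal labels mean that \<open>e\<close> is not isolated in its level.\<close>
      moreover have "e \<notin> L" using g_L uv False by blast
      ultimately have "satisfied (H q) (h q) e" using h_sat \<open>e \<in> F\<close> unfolding L_def q_def by blast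
      then obtain e' b where e': "e' \<in> H q" "e' \<noteq> e" "e' \<inter> e \<noteq> {}" "h q e' = Some b"
        and uniq: "\<And>e''. e'' \<in> H q \<Longrightarrow> e'' \<inter> e \<noteq> {} \<Longrightarrow> h q e'' = Some b \<Longrightarrow> e'' = e'"
        by (rule satisfiedE) (rule that)
      have "b < 3" using h e'(4) by blast
      have "e' \<in> E" using e'(1) \<open>F \<subseteq> E\<close> unfolding H_def by blast
      then show ?thesis
      proof (rule satisfiedI)
        show "c e' = Some (3 * q + 8 + b)" using c_high[OF \<open>b < 3\<close> \<open>q > 0\<close>] e'(4) by blast
        fix e'' assume "e'' \<inter> e \<noteq> {}" "c e'' = Some (3 * q + 8 + b)"
        then show "e'' = e'" using c_high[OF \<open>b < 3\<close> \<open>q > 0\<close>] h uniq by blast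
      qed fact+
    qed
  qed
qed

end
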